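(* Let $T$ be a tree with $\ell\ge 2$ leaves. Then $T$ is $2$-sparse if and only if $P(T)=\ell-1$.
   Context: Graphs are finite and simple. A path covering of a graph $G$ is a set of vertex-disjoint paths of $G$ (a single vertex counts as a path) containing all the vertices of $G$; the path covering number $P(G)$ is the minimum number of paths in a path covering of $G$. A leaf is a vertex of degree $1$. A graph is $2$-sparse if it contains no pair of adjacent vertices both of degree greater than $2$. *)

theory Defs
  imports "Graph_Theory.Graph_Theory"
begin

text \<open>
  Finite simple graphs are the structures satisfying \<^locale>\<open>graph\<close>: finite symmetric
  digraphs without loops and without parallel arcs. An undirected edge is thus a pair of
  opposite arcs, and the degree of a vertex is its out-degree.
\<close>

abbreviation degree :: "('a, 'b) pre_digraph \<Rightarrow> 'a \<Rightarrow> nat" where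
  "degree G v \<equiv> out_degree G v"

text \<open>
  The library's \<^const>\<open>forest\<close> and \<^const>\<open>tree\<close> are not usable for symmetric
  digraphs: an arc followed by its opposite is a \<^const>\<open>pre_digraph.cycle\<close> of length 2.
  The cycles of the undirected graph are exactly the cycles of length at least 3.
\<close>

definition undirected_tree :: "('a, 'b) pre_digraph \<Rightarrow> bool" where
  "undirected_tree G \<longleftrightarrow> graph G \<and> Digraph_Component.connected G \<and>
     \<not> (\<exists>p. pre_digraph.cycle G p \<and> length p \<ge> 3)"

definition leaves :: "('a, 'b) pre_digraph \<Rightarrow> 'a set" where
  "leaves G = {v \<in> verts G. degree G v = 1}"

definition two_sparse :: "('a, 'b) pre_digraph \<Rightarrow> bool" where
  "two_sparse G \<longleftrightarrow> \<not> (\<exists>u v. u \<rightarrow>\<^bsub>G\<^esub> v \<and> degree G u > 2 \<and> degree G v > 2)"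

text \<open>
  A path is given by its list of vertices, which by definition of \<^const>\<open>vpath\<close> is
  nonempty and distinct; one-element lists are allowed. A path and its reversal are
  different lists but never both belong to a covering, because they share vertices; so the
  cardinality of a covering is its number of paths.
\<close>

definition path_covering :: "('a, 'b) pre_digraph \<Rightarrow> 'a list set \<Rightarrow> bool" where
  "path_covering G \<P> \<longleftrightarrow> finite \<P> \<and> (\<forall>p\<in>\<P>. vpath p G) \<and>
     pairwise (\<lambda>p q. disjnt (set p) (set q)) \<P> \<and> (\<Union>p\<in>\<P>. set p) = verts G"

definition path_covering_number :: "('a, 'b) pre_digraph \<Rightarrow> nat" where
  "path_covering_number G = (LEAST k. \<exists>\<P>. path_covering G \<P> \<and> card \<P> = k)"

text \<open>The minimum is attained, since one-vertex paths always give a covering.\<close>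

lemma path_covering_singletons:
  assumes "finite (verts G)"
  shows "path_covering G ((\<lambda>v. [v]) ` verts G)"
  using assms by (auto simp: path_covering_def vpath_def vwalk_def pairwise_def)

lemma path_covering_number_attained:
  assumes "finite (verts G)"
  obtains \<P> where "path_covering G \<P>" "card \<P> = path_covering_number G"
  using LeastI_ex[of "\<lambda>k. \<exists>\<P>. path_covering G \<P> \<and> card \<P> = k"]
    path_covering_singletons[OF assms]
  unfolding path_covering_number_def by blast

end

theory Submission
  imports Defs
begin

text \<open>
  A covering of the tree by k paths amounts to deleting k - 1 edges so that every degree
  becomes at most 2. A vertex of degree d > 2 must lose d - 2 edges, and since a tree on n vertices
  has n - 1 edges, the sum of these excesses d - 2 is l - 2. Deleting edges greedily
  shows P(T) \<le> l - 1. If the tree is 2-sparse, no deleted edge serves two vertices, so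
  l - 2 deletions are necessary; otherwise an edge between two vertices of degree above 2
  serves both, and l - 3 deletions suffice.

  Edge sets are symmetric relations, so each edge counts twice in cardinalities.
\<close>

subsection \<open>Paths and cycles in symmetric relations\<close>

fun path_edges :: "'a list \<Rightarrow> 'a rel" where
  "path_edges (x # y # p) = {(x, y), (y, x)} \<union> path_edges (y # p)"
| "path_edges _ = {}"

lemma path_edges_subset: "path_edges p \<subseteq> set p \<times> set p"
  by (induction p rule: path_edges.induct) auto

lemma finite_path_edges [simp]: "finite (path_edges p)"
  by (rule finite_subset[OF path_edges_subset]) auto

lemma path_edges_append:
  assumes "p \<noteq> []" "q \<noteq> []"
  shows "path_edges (p @ q) =
    path_edges p \<union> {(last p, hd q), (hd q, last p)} \<union> path_edges q"
  using assms
proof (induction p rule: path_edges.induct)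
  case ("2_2" x)
  then show ?case by (cases q) auto
qed auto

lemma path_edges_Cons: "q \<noteq> [] \<Longrightarrow> path_edges (x # q) = {(x, hd q), (hd q, x)} \<union> path_edges q"
  by (cases q) auto

lemma path_edges_rev: "path_edges (rev p) = path_edges p"
proof (induction p)
  case (Cons x p)
  then show ?case
    by (cases "p = []") (auto simp: path_edges_append path_edges_Cons last_rev)
qed simp

lemma sym_path_edges: "sym (path_edges p)"
  by (induction p rule: path_edges.induct) (auto simp: sym_def)

lemma path_edges_eq_vwalk_arcs: "path_edges p = set (vwalk_arcs p) \<union> (set (vwalk_arcs p))\<inverse>"
  by (induction p rule: path_edges.induct) auto

lemma card_path_edges:
  assumes "distinct p" "p \<noteq> []"
  shows "card (path_edges p) + 2 = 2 * length p"
  using assms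
proof (induction p rule: path_edges.induct)
  case (1 x y p)
  have "(x, y) \<notin> path_edges (y # p)" "(y, x) \<notin> path_edges (y # p)" "x \<noteq> y"
    using path_edges_subset[of "y # p"] 1(2) by auto
  with 1 show ?case by simp
qed auto

text \<open>Only the predecessor and the successor in the list count as neighbours. Both the bound 2
  on degrees and the recognition of end vertices are read off from this case split.\<close>

lemma path_edges_Image_middle:
  assumes "distinct (xs @ u # ys)"
  shows "path_edges (xs @ u # ys) `` {u} =
    (if xs = [] then {} else {last xs}) \<union> (if ys = [] then {} else {hd ys})"
proof -
  have *: "path_edges xs `` {u} = {}" "path_edges ys `` {u} = {}"
    using assms path_edges_subset[of xs] path_edges_subset[of ys] by auto
  have "u \<notin> set xs" "u \<notin> set ys" using assms by auto
  then have "xs \<noteq> [] \<Longrightarrow> last xs \<noteq> u" "ys \<noteq> [] \<Longrightarrow> hd ys \<noteq> u"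
    using last_in_set hd_in_set by metis+
  with * show ?thesis
    by (cases "xs = []"; cases "ys = []") (auto simp: path_edges_append path_edges_Cons)
qed

lemma path_edges_degree_le: "distinct p \<Longrightarrow> card (path_edges p `` {u}) \<le> 2"
proof (cases "u \<in> set p")
  case True
  assume "distinct p"
  moreover from True obtain xs ys where "p = xs @ u # ys" by (meson split_list)
  ultimately show ?thesis by (auto simp: path_edges_Image_middle card_insert_if)
next
  case False
  then have "path_edges p `` {u} = {}" using path_edges_subset[of p] by auto
  then show ?thesis by simp
qed

text \<open>An interior vertex has two neighbours, and distinctness keeps them apart.\<close>

lemma path_edges_endpoint:
  assumes "distinct p" "u \<in> set p" "card (path_edges p `` {u}) < 2"
  shows "hd p = u \<or> last p = u"
proof -
  obtain xs ys where p: "p = xs @ u # ys" using assms(2) by (meson split_list)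
  have "xs = [] \<or> ys = []"
  proof (rule ccontr)
    assume "\<not> ?thesis"
    moreover from this have "last xs \<noteq> hd ys" using assms(1) p
      by (metis disjoint_iff distinct_append hd_in_set last_in_set list.set_intros(2))
    ultimately show False using assms(1,3) p by (simp add: path_edges_Image_middle)
  qed
  then show ?thesis using p by auto
qed

section \<open>Acyclic relations and the edge count of a tree\<close>

text \<open>A cycle is a path together with a closing pair. The bound 3 excludes a single edge
  traversed back and forth, which a symmetric relation always admits.\<close>

definition cycle_free :: "'a rel \<Rightarrow> bool" where
  "cycle_free R \<longleftrightarrow> (\<forall>p. distinct p \<longrightarrow> length p \<ge> 3 \<longrightarrow> path_edges p \<subseteq> R \<longrightarrow> (last p, hd p) \<notin> R)"

lemma cycle_free_subset: "cycle_free R \<Longrightarrow> S \<subseteq> R \<Longrightarrow> cycle_free S"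
  unfolding cycle_free_def by blast

text \<open>Take a longest path. A second neighbour of its first vertex would extend the path if it
  lay outside, and close a cycle if it lay on the path.\<close>

lemma cycle_free_leaf:
  assumes V: "finite V" "R \<subseteq> V \<times> V" and R: "sym R" "irrefl R" "cycle_free R" "R \<noteq> {}"
  obtains x y where "R `` {x} = {y}"
proof -
  define Q where "Q p \<longleftrightarrow> distinct p \<and> set p \<subseteq> V \<and> path_edges p \<subseteq> R" for p
  have bound: "length p < Suc (card V)" if "Q p" for p
    using that V(1) unfolding Q_def by (metis card_mono distinct_card less_Suc_eq_le)
  obtain a b where ab: "(a, b) \<in> R" using R(4) by auto
  have Qab: "Q [a, b]"
    using ab V(2) R(1,2) unfolding Q_def irrefl_def sym_def by auto
  obtain p where p: "Q p" and max: "\<And>q. Q q \<Longrightarrow> length q \<le> length p"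
    using ex_has_greatest_nat[of Q, OF Qab, of length "Suc (card V)"] bound by auto
  from max[OF Qab] obtain x y ps where pxy: "p = x # y # ps"
    by (auto simp: numeral_2_eq_2 Suc_le_length_iff)
  have "z = y" if z: "(x, z) \<in> R" for z
  proof (rule ccontr)
    assume "z \<noteq> y"
    have "z \<noteq> x" using z R(2) by (auto simp: irrefl_def)
    have zx: "(z, x) \<in> R" using z R(1) by (auto simp: sym_def)
    show False
    proof (cases "z \<in> set ps")
      case True
      then obtain as bs where ps: "ps = as @ z # bs" by (meson split_list)
      \<comment> \<open>The initial segment of \<open>p\<close> up to \<open>z\<close>; the edge
        from \<open>z\<close> back to \<open>x\<close> closes it, and \<open>y\<close> in between
        makes it long enough to be a cycle.\<close>
      let ?q = "x # y # as @ [z]"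
      have "path_edges ?q \<subseteq> path_edges p"
        using path_edges_append[of ?q bs] unfolding pxy ps by (cases "bs = []") auto
      then have "path_edges ?q \<subseteq> R" "distinct ?q" "length ?q \<ge> 3"
        using p unfolding Q_def pxy ps by auto
      then have "(last ?q, hd ?q) \<notin> R" using R(3) unfolding cycle_free_def by blast
      then show False using zx by simp
    next
      case False
      then have "Q (z # p)"
        using p z zx V(2) \<open>z \<noteq> x\<close> \<open>z \<noteq> y\<close> unfolding Q_def pxy by auto
      then show False using max by fastforce
    qed
  qed
  moreover have "(x, y) \<in> R" using p unfolding Q_def pxy by auto
  ultimately show thesis using that by blast
qed

text \<open>Induction on the number of vertices: removing a leaf together with its only edge lowers
  \<open>card R\<close> by 2 and \<open>card V\<close> by 1, and keeps the rest connected and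
  acyclic.\<close>

lemma card_tree_edges:
  assumes "finite V" "R \<subseteq> V \<times> V" "sym R" "irrefl R" "cycle_free R" "V \<noteq> {}"
    "V \<times> V \<subseteq> R\<^sup>*"
  shows "card R + 2 = 2 * card V"
  using assms
proof (induction "card V" arbitrary: V R)
  case 0
  then show ?case by simp
next
  case (Suc n)
  show ?case
  proof (cases "R = {}")
    case True
    then obtain x where "V = {x}" using Suc.prems by (metis Image_closed_trancl Image_empty2
        mem_Sigma_iff is_singletonI' is_singleton_the_elem rtrancl_empty pair_in_Id_conv subsetD)
    then show ?thesis using True by simp
  next
    case False
    then obtain x y where xy: "R `` {x} = {y}"
      using cycle_free_leaf Suc.prems by metis
    have yx: "(x, y) \<in> R" "(y, x) \<in> R" "x \<noteq> y" "x \<in> V" "y \<in> V"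
      using xy Suc.prems(2,3,4) by (auto simp: sym_def irrefl_def)
    define R' where "R' = R - {(x, y), (y, x)}"
    have only: "(x, z) \<in> R \<Longrightarrow> z = y" "(z, x) \<in> R \<Longrightarrow> z = y" for z
      using xy Suc.prems(3) by (auto simp: sym_def)
    have "(u, w) \<in> R'\<^sup>*" if "u \<in> V - {x}" "w \<in> V - {x}" for u w
    proof -
      have "(u, w) \<in> R\<^sup>*" using that Suc.prems(7) by auto
      \<comment> \<open>A walk can enter or leave the leaf \<open>x\<close> only through
        \<open>y\<close>. Reading \<open>y\<close> for \<open>x\<close> turns such steps into pauses
        at \<open>y\<close>, so the walk avoids \<open>x\<close>.\<close>
      then have "(u, if w = x then y else w) \<in> R'\<^sup>*"
      proof (induction rule: rtrancl_induct)
        case base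
        then show ?case using that by simp
      next
        case (step v w)
        show ?case
        proof (cases "v = x \<or> w = x")
          case True
          then show ?thesis using step only yx(3) by (auto split: if_splits)
        next
          case False
          then have "(v, w) \<in> R'" using step(2) by (auto simp: R'_def)
          then show ?thesis using step(3) False by auto
        qed
      qed
      then show ?thesis using that by auto
    qed
    moreover have "R' \<subseteq> (V - {x}) \<times> (V - {x})"
      using Suc.prems(2) only unfolding R'_def by auto
    moreover have "n = card (V - {x})" using Suc.hyps(2) Suc.prems(1) yx(4) by simp
    moreover have "sym R'" using Suc.prems(3) unfolding R'_def sym_def by auto
    moreover have "irrefl R'" using Suc.prems(4) unfolding R'_def irrefl_def by auto
    moreover have "cycle_free R'" by (rule cycle_free_subset[OF Suc.prems(5)]) (auto simp: R'_def)
    ultimately have "card R' + 2 = 2 * card (V - {x})"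
      using yx(3,5) Suc.prems(1) by (intro Suc.hyps(1)) auto
    moreover have fR: "finite R" using Suc.prems(1,2) by (meson finite_SigmaI finite_subset)
    have "R = insert (x, y) (insert (y, x) R')" "(x, y) \<notin> R'" "(y, x) \<notin> R'"
      using yx unfolding R'_def by auto
    then have "card R = card R' + 2" using yx(3) fR by (simp add: finite_subset)
    ultimately show ?thesis using Suc.hyps(2) Suc.prems(1) yx(4) by simp
  qed
qed

subsection \<open>Partitions into paths\<close>

text \<open>No edge relation is mentioned: the union of the \<open>path_edges\<close> is compared
  with varying relations while edges are deleted and restored.\<close>

definition path_partition :: "'a set \<Rightarrow> 'a list set \<Rightarrow> bool" where
  "path_partition V P \<longleftrightarrow> finite P \<and> (\<forall>p\<in>P. p \<noteq> [] \<and> distinct p) \<and>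
     pairwise (\<lambda>p q. disjnt (set p) (set q)) P \<and> (\<Union>p\<in>P. set p) = V"

lemma path_partition_unique:
  assumes "path_partition V P" "p \<in> P" "q \<in> P" "u \<in> set p" "u \<in> set q"
  shows "p = q"
  using assms by (auto simp: path_partition_def pairwise_def disjnt_iff)

text \<open>A path on k vertices contributes 2(k - 1) arcs. Hence minimising the number of paths
  means maximising the number of edges kept.\<close>

lemma card_edges_path_partition:
  assumes "path_partition V P"
  shows "card (\<Union>p\<in>P. path_edges p) + 2 * card P = 2 * card V"
proof -
  have P: "finite P" "(\<Union>p\<in>P. set p) = V" "\<And>p. p \<in> P \<Longrightarrow> p \<noteq> [] \<and> distinct p"
    using assms by (auto simp: path_partition_def)
  have *: "\<forall>p\<in>P. \<forall>q\<in>P. p \<noteq> q \<longrightarrow> set p \<inter> set q = {}"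
    using path_partition_unique[OF assms] by blast
  then have "\<forall>p\<in>P. \<forall>q\<in>P. p \<noteq> q \<longrightarrow> path_edges p \<inter> path_edges q = {}"
    using path_edges_subset by blast
  then have "card (\<Union>p\<in>P. path_edges p) = (\<Sum>p\<in>P. card (path_edges p))"
    using P(1) by (intro card_UN_disjoint) auto
  then have "card (\<Union>p\<in>P. path_edges p) + 2 * card P = (\<Sum>p\<in>P. card (path_edges p) + 2)"
    by (simp add: sum.distrib del: add_2_eq_Suc')
  also have "\<dots> = (\<Sum>p\<in>P. 2 * card (set p))"
    using P(3) by (intro sum.cong) (auto simp: card_path_edges distinct_card simp del: add_2_eq_Suc')
  also have "\<dots> = 2 * card (\<Union>p\<in>P. set p)"
    using P(1) * by (subst card_UN_disjoint) (auto simp: sum_distrib_left)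
  finally show ?thesis using P(2) by simp
qed

lemma path_partition_Image:
  assumes "path_partition V P" "p \<in> P" "u \<in> set p"
  shows "(\<Union>p\<in>P. path_edges p) `` {u} = path_edges p `` {u}"
proof -
  have "q = p" if "q \<in> P" "(u, v) \<in> path_edges q" for q v
    using that path_edges_subset[of q] path_partition_unique[OF assms(1)] assms(2,3) by blast
  then show ?thesis using assms(2) by blast
qed

lemma path_partition_degree_le:
  assumes "path_partition V P"
  shows "card ((\<Union>p\<in>P. path_edges p) `` {u}) \<le> 2"
proof (cases "u \<in> V")
  case True
  then obtain p where "p \<in> P" "u \<in> set p" using assms by (auto simp: path_partition_def)
  then show ?thesis
    using path_partition_Image[OF assms] path_edges_degree_le assms
    by (metis path_partition_def)
next
  case False
  then have "(\<Union>p\<in>P. path_edges p) `` {u} = {}"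
    using assms path_edges_subset unfolding path_partition_def by fastforce
  then show ?thesis by simp
qed

text \<open>The copies \<open>p'\<close> and \<open>q'\<close> may be reversals of \<open>p\<close>
  and \<open>q\<close>, so that any end of one path can be joined to any end of the other.\<close>

lemma path_partition_merge:
  assumes P: "path_partition V P" and "p \<in> P" "q \<in> P" "p \<noteq> q"
    and p': "set p' = set p" "distinct p'" "path_edges p' = path_edges p"
    and q': "set q' = set q" "distinct q'" "path_edges q' = path_edges q"
  defines "P' \<equiv> insert (p' @ q') (P - {p, q})"
  shows "path_partition V P'"
    and "(\<Union>p\<in>P'. path_edges p) =
      {(last p', hd q'), (hd q', last p')} \<union> (\<Union>p\<in>P. path_edges p)"
proof -
  have ne: "p' \<noteq> []" "q' \<noteq> []"
    using P assms(2,3) p'(1) q'(1) by (auto simp: path_partition_def)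
  have PE: "P = insert p (insert q (P - {p, q}))" using assms(2,3) by auto
  have d: "set r \<inter> set s = {}" if "r \<in> P" "s \<in> P" "r \<noteq> s" for r s
    using path_partition_unique[OF P] that by blast
  have "pairwise (\<lambda>p q. disjnt (set p) (set q)) P'"
    unfolding P'_def pairwise_insert
  proof (intro conjI allI impI)
    show "pairwise (\<lambda>p q. disjnt (set p) (set q)) (P - {p, q})"
      using P by (auto simp: path_partition_def intro: pairwise_subset)
  next
    fix r assume "r \<in> P - {p, q} \<and> r \<noteq> p' @ q'"
    then show "disjnt (set (p' @ q')) (set r)" "disjnt (set r) (set (p' @ q'))"
      using d[of p r] d[of q r] assms(2,3) p'(1) q'(1) by (auto simp: disjnt_def)
  qed
  moreover have "(\<Union>p\<in>P'. set p) = (\<Union>p\<in>P. set p)"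
    by (subst PE) (auto simp: P'_def p'(1) q'(1))
  moreover have "distinct (p' @ q')" using d[OF assms(2-4)] p' q' by auto
  ultimately show "path_partition V P'"
    using P ne unfolding path_partition_def by (auto simp: P'_def)
  show "(\<Union>p\<in>P'. path_edges p) =
      {(last p', hd q'), (hd q', last p')} \<union> (\<Union>p\<in>P. path_edges p)"
    by (subst PE) (auto simp: P'_def path_edges_append ne p'(3) q'(3))
qed

text \<open>Induction on the number of arcs: take out one edge, partition what remains, and put the
  edge back by joining the two paths that end at its ends.\<close>

lemma linear_forest_path_partition:
  assumes "finite V" "R \<subseteq> V \<times> V" "sym R" "irrefl R" "cycle_free R"
    and "\<And>u. card (R `` {u}) \<le> 2"
  shows "\<exists>P. path_partition V P \<and> (\<Union>p\<in>P. path_edges p) = R"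
  using assms
proof (induction "card R" arbitrary: R rule: less_induct)
  case less
  show ?case
  proof (cases "R = {}")
    case True
    have "path_partition V ((\<lambda>v. [v]) ` V)"
      using less.prems(1) by (auto simp: path_partition_def pairwise_def)
    then show ?thesis using True by (intro exI[of _ "(\<lambda>v. [v]) ` V"]) auto
  next
    case False
    have fR: "finite R" using less.prems(1,2) by (meson finite_SigmaI finite_subset)
    obtain u v where uv: "(u, v) \<in> R" using False by auto
    then have vu: "(v, u) \<in> R" "u \<noteq> v" "u \<in> V" "v \<in> V"
      using less.prems(2) symD[OF less.prems(3)] irreflD[OF less.prems(4)] by blast+
    define S where "S = R - {(u, v), (v, u)}"
    have SR: "S \<subseteq> R" by (auto simp: S_def)
    have deg_le: "card (S `` {w}) \<le> card (R `` {w})" for w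
      using SR fR by (intro card_mono) (auto simp: finite_Image)
    have lt: "card S < card R" using SR uv fR by (intro psubset_card_mono) (auto simp: S_def)
    have symS: "sym S" "irrefl S"
      using less.prems(3,4) unfolding S_def sym_def irrefl_def by blast+
    have SV: "S \<subseteq> V \<times> V" using SR less.prems(2) by blast
    obtain P where P: "path_partition V P" and PS: "(\<Union>p\<in>P. path_edges p) = S"
      using less.hyps[OF lt less.prems(1) SV symS cycle_free_subset[OF less.prems(5) SR]
        order_trans[OF deg_le less.prems(6)]] by blast
    \<comment> \<open>A vertex that lost an edge has degree at most 1 in \<open>S\<close>, so it is
      an end of its path.\<close>
    have end_path: "\<exists>p\<in>P. w \<in> set p \<and> (hd p = w \<or> last p = w)"
      if w: "(w, z) \<in> R - S" "w \<in> V" for w z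
    proof -
      obtain p where p: "p \<in> P" "w \<in> set p" using P w by (auto simp: path_partition_def)
      have "S `` {w} \<subset> R `` {w}" using SR w(1) by blast
      then have "card (S `` {w}) < card (R `` {w})"
        using fR by (intro psubset_card_mono finite_Image)
      also note less.prems(6)
      finally have "card (path_edges p `` {w}) < 2"
        using path_partition_Image[OF P p] unfolding PS by (simp only:)
      moreover have "distinct p" using P p(1) by (simp add: path_partition_def)
      ultimately have "hd p = w \<or> last p = w" using path_edges_endpoint p(2) by metis
      then show ?thesis using p by blast
    qed
    have uvS: "(u, v) \<in> R - S" and vuS: "(v, u) \<in> R - S"
      using uv vu(1) by (auto simp: S_def)
    obtain p where p: "p \<in> P" "u \<in> set p" "hd p = u \<or> last p = u"
      using end_path[OF uvS vu(3)] by blast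
    obtain q where q: "q \<in> P" "v \<in> set q" "hd q = v \<or> last q = v"
      using end_path[OF vuS vu(4)] by blast
    have dist: "distinct p" "distinct q" using P p(1) q(1) by (auto simp: path_partition_def)
    \<comment> \<open>Otherwise the removed edge joins the two ends of one path. With three or more
      vertices this closes a cycle in \<open>R\<close>; with two, the path would itself use the
      removed edge.\<close>
    have "p \<noteq> q"
    proof
      assume "p = q"
      then have ends: "hd p = u \<and> last p = v \<or> hd p = v \<and> last p = u" using p q vu(2) by auto
      have sub: "path_edges p \<subseteq> S" using PS p(1) by blast
      have "(last p, hd p) \<in> R" using ends uv vu(1) by auto
      then have "length p < 3"
        using less.prems(5) dist(1) order_trans[OF sub SR] unfolding cycle_free_def
        by (meson not_le)
      then obtain x y where "p = [x, y]"
        using ends vu(2) p(2) by (cases p rule: path_edges.cases) auto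
      then show False using sub ends by (auto simp: S_def)
    qed
    \<comment> \<open>Orient the paths so that the first ends in \<open>u\<close> and the second
      starts in \<open>v\<close>.\<close>
    define p' where "p' = (if last p = u then p else rev p)"
    define q' where "q' = (if hd q = v then q else rev q)"
    have ends: "last p' = u" "hd q' = v"
      using p q by (auto simp: p'_def q'_def last_rev hd_rev)
    have "set p' = set p" "distinct p'" "path_edges p' = path_edges p"
      "set q' = set q" "distinct q'" "path_edges q' = path_edges q"
      using dist by (auto simp: p'_def q'_def path_edges_rev)
    note merged = path_partition_merge[OF P p(1) q(1) \<open>p \<noteq> q\<close> this, unfolded ends PS]
    have "{(u, v), (v, u)} \<union> S = R" using uv vu by (auto simp: S_def)
    with merged show ?thesis by (intro exI conjI) (assumption, simp only:)
  qed
qed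

subsection \<open>Excess degrees\<close>

text \<open>Truncated subtraction makes vertices of degree at most 2 contribute 0.\<close>

definition excess :: "'a set \<Rightarrow> 'a rel \<Rightarrow> nat" where
  "excess V R = (\<Sum>v\<in>V. card (R `` {v}) - 2)"

lemma remove_edge:
  assumes "finite R" "sym R" "irrefl R" "(u, v) \<in> R"
  defines "S \<equiv> R - {(u, v), (v, u)}"
  shows "S \<subseteq> R" "sym S" "irrefl S" "card R = card S + 2"
    and "card (R `` {u}) = card (S `` {u}) + 1" "card (R `` {v}) = card (S `` {v}) + 1"
    and "\<And>w. w \<noteq> u \<Longrightarrow> w \<noteq> v \<Longrightarrow> S `` {w} = R `` {w}"
proof -
  have uv: "(v, u) \<in> R" "u \<noteq> v" using assms by (auto simp: sym_def irrefl_def)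
  show "S \<subseteq> R" "sym S" "irrefl S" using assms by (auto simp: sym_def irrefl_def)
  have fS: "finite S" using assms(1) by (simp add: S_def)
  have "R = insert (u, v) (insert (v, u) S)" "(u, v) \<notin> S" "(v, u) \<notin> S"
    using uv assms(4) by (auto simp: S_def)
  then show "card R = card S + 2" using uv(2) fS by simp
  have "R `` {u} = insert v (S `` {u})" "v \<notin> S `` {u}"
    "R `` {v} = insert u (S `` {v})" "u \<notin> S `` {v}"
    using uv assms(4) by (auto simp: S_def)
  then show "card (R `` {u}) = card (S `` {u}) + 1" "card (R `` {v}) = card (S `` {v}) + 1"
    using fS by (simp_all add: finite_Image)
  show "\<And>w. w \<noteq> u \<Longrightarrow> w \<noteq> v \<Longrightarrow> S `` {w} = R `` {w}" by (auto simp: S_def)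
qed

text \<open>The term of \<open>u\<close> drops by 1. The term of \<open>v\<close> drops by 1 as well
  if its degree exceeds 2, and is 0 before and after otherwise.\<close>

lemma excess_remove_edge:
  assumes "finite V" "R \<subseteq> V \<times> V" "sym R" "irrefl R" "(u, v) \<in> R" "card (R `` {u}) > 2"
  shows "excess V (R - {(u, v), (v, u)}) + (if card (R `` {v}) > 2 then 2 else 1) \<le> excess V R"
proof -
  define S where "S = R - {(u, v), (v, u)}"
  have "finite R" using assms(1,2) by (meson finite_SigmaI finite_subset)
  note rem = remove_edge[OF this assms(3-5), folded S_def]
  have uv: "u \<in> V" "v \<in> V" "u \<noteq> v" using assms by (auto simp: irrefl_def)
  have V: "V = insert u (insert v (V - {u, v}))" using uv by auto
  have "(\<Sum>w\<in>V - {u, v}. card (S `` {w}) - 2) = (\<Sum>w\<in>V - {u, v}. card (R `` {w}) - 2)"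
    using rem(7) by (intro sum.cong) auto
  moreover have "(\<Sum>w\<in>V. f w) = f u + f v + (\<Sum>w\<in>V - {u, v}. f w)" for f :: "'a \<Rightarrow> nat"
    using assms(1) uv(3) by (subst V) simp
  ultimately show ?thesis
    using rem(5,6) assms(6) unfolding excess_def S_def[symmetric] by auto
qed

text \<open>Greedy: deleting an edge at a vertex of degree above 2 lowers the excess by at least 1.\<close>

lemma exists_degree_le_2_subset:
  assumes "finite V" "R \<subseteq> V \<times> V" "sym R" "irrefl R"
  shows "\<exists>S\<subseteq>R. sym S \<and> irrefl S \<and> (\<forall>u. card (S `` {u}) \<le> 2) \<and>
    card R \<le> card S + 2 * excess V R"
  using assms
proof (induction "card R" arbitrary: R rule: less_induct)
  case less
  show ?case
  proof (cases "\<forall>u. card (R `` {u}) \<le> 2")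
    case True
    then show ?thesis using less.prems by auto
  next
    case False
    then obtain u where u: "card (R `` {u}) > 2" by (auto simp: not_le)
    then obtain v where v: "(u, v) \<in> R" by (cases "R `` {u} = {}") auto
    have "finite R" using less.prems(1,2) by (meson finite_SigmaI finite_subset)
    note rem = remove_edge[OF this less.prems(3,4) v]
    let ?R' = "R - {(u, v), (v, u)}"
    have "card ?R' < card R" "?R' \<subseteq> V \<times> V" using rem(4) less.prems(2) by auto
    from less.hyps[OF this(1) less.prems(1) this(2) rem(2,3)]
    obtain S where S: "S \<subseteq> ?R'" "sym S" "irrefl S" "\<forall>u. card (S `` {u}) \<le> 2"
      "card ?R' \<le> card S + 2 * excess V ?R'"
      by blast
    have "excess V ?R' + 1 \<le> excess V R"
      using excess_remove_edge[OF less.prems v u] by (simp split: if_splits)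
    \<comment> \<open>The two arcs removed are paid for by the drop of at least 1 in the excess,
      which counts double.\<close>
    then have "card R \<le> card S + 2 * excess V R" using S(5) rem(4) by linarith
    moreover have "S \<subseteq> R" using S(1) by blast
    ultimately show ?thesis using S(2-4) by blast
  qed
qed

text \<open>After the greedy deletion the remaining edges form disjoint paths, whose number follows
  from the arc count. When \<open>card R + 2 = 2 * card V\<close> this gives at most
  \<open>excess V R + 1\<close> paths; connectedness is not assumed, so it also applies after an
  edge of the tree is removed.\<close>

lemma exists_path_partition:
  assumes "finite V" "R \<subseteq> V \<times> V" "sym R" "irrefl R" "cycle_free R"
  shows "\<exists>P. path_partition V P \<and> (\<Union>p\<in>P. path_edges p) \<subseteq> R \<and>
    card R + 2 * card P \<le> 2 * card V + 2 * excess V R"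
proof -
  obtain S where S: "S \<subseteq> R" "sym S" "irrefl S" "\<forall>u. card (S `` {u}) \<le> 2"
    "card R \<le> card S + 2 * excess V R"
    using exists_degree_le_2_subset[OF assms(1-4)] by blast
  have SV: "S \<subseteq> V \<times> V" using S(1) assms(2) by blast
  obtain P where "path_partition V P" "(\<Union>p\<in>P. path_edges p) = S"
    using linear_forest_path_partition[OF assms(1) SV S(2,3) cycle_free_subset[OF assms(5) S(1)]]
      S(4) by blast
  with card_edges_path_partition[of V P] S show ?thesis by (intro exI[of _ P]) auto
qed

section \<open>The excess of a tree and the lower bound under sparsity\<close>

lemma card_eq_sum_degrees:
  assumes "finite V" "R \<subseteq> V \<times> V"
  shows "card R = (\<Sum>v\<in>V. card (R `` {v}))"
proof -
  have "R = (SIGMA v:V. R `` {v})" using assms(2) by auto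
  moreover have "finite (R `` {v})" for v
    using assms by (meson finite_Image finite_SigmaI finite_subset)
  ultimately show ?thesis using card_SigmaI[of V "\<lambda>v. R `` {v}"] assms(1) by simp
qed

text \<open>Sum the identity of truncated differences (d - 2) + 2 = d + [d = 1], valid for every
  degree d > 0, and insert the arc count of a tree.\<close>

lemma tree_excess:
  assumes "finite V" "R \<subseteq> V \<times> V" "card R + 2 = 2 * card V" "\<And>v. v \<in> V \<Longrightarrow> R `` {v} \<noteq> {}"
  shows "excess V R + 2 = card {v \<in> V. card (R `` {v}) = 1}"
proof -
  have "card (R `` {v}) \<noteq> 0" if "v \<in> V" for v
    using assms(4)[OF that] assms(1,2) by (metis card_0_eq finite_Image finite_SigmaI finite_subset)
  then have "(card (R `` {v}) - 2) + 2 = card (R `` {v}) + (if card (R `` {v}) = 1 then 1 else 0)"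
    if "v \<in> V" for v
    using that[THEN \<open>\<And>v. v \<in> V \<Longrightarrow> card (R `` {v}) \<noteq> 0\<close>] by auto
  then have "(\<Sum>v\<in>V. (card (R `` {v}) - 2) + 2) =
      (\<Sum>v\<in>V. card (R `` {v}) + (if card (R `` {v}) = 1 then 1 else 0))"
    by (intro sum.cong) auto
  then have "excess V R + 2 * card V = card R + card {v \<in> V. card (R `` {v}) = 1}"
    using assms(1) card_eq_sum_degrees[OF assms(1,2)]
    by (simp add: sum.distrib excess_def sum.If_cases Int_def del: add_2_eq_Suc')
  then show ?thesis using assms(3) by simp
qed

text \<open>A vertex of degree d > 2 in \<open>R\<close> loses at least d - 2 edges on passing to
  \<open>S\<close>, and sparsity prevents charging one edge to two such vertices. Taking for
  \<open>S\<close> the edges of a path covering bounds the number of paths from below.\<close>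

lemma two_sparse_excess_le:
  assumes "finite V" "R \<subseteq> V \<times> V" "sym R"
    and sparse: "\<And>u v. (u, v) \<in> R \<Longrightarrow> card (R `` {u}) > 2 \<Longrightarrow> card (R `` {v}) \<le> 2"
    and S: "S \<subseteq> R" "sym S" "\<And>u. card (S `` {u}) \<le> 2"
  shows "card S + 2 * excess V R \<le> card R"
proof -
  have fR: "finite R" using assms(1,2) by (meson finite_SigmaI finite_subset)
  define B where "B = {v \<in> V. card (R `` {v}) > 2}"
  \<comment> \<open>By sparsity a deleted edge has at most one end in \<open>B\<close>, so its two arcs are never both in \<open>D\<close>.\<close>
  define D where "D = (SIGMA v:B. (R - S) `` {v})"
  have DR: "D \<subseteq> R - S" by (auto simp: D_def)
  have "excess V R = (\<Sum>v\<in>B. card (R `` {v}) - 2)"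
    unfolding excess_def B_def using assms(1) by (intro sum.mono_neutral_right) auto
  also have "\<dots> \<le> (\<Sum>v\<in>B. card ((R - S) `` {v}))"
  proof (intro sum_mono)
    fix v
    have "R `` {v} - S `` {v} \<subseteq> (R - S) `` {v}" by auto
    then have "card (R `` {v} - S `` {v}) \<le> card ((R - S) `` {v})"
      using fR by (intro card_mono) (auto simp: finite_Image)
    moreover have "card (R `` {v}) - card (S `` {v}) \<le> card (R `` {v} - S `` {v})"
      by (intro diff_card_le_card_Diff) (meson S(1) fR finite_Image finite_subset)
    ultimately show "card (R `` {v}) - 2 \<le> card ((R - S) `` {v})" using S(3)[of v] by linarith
  qed
  also have "\<dots> = card D"
    using assms(1) fR unfolding D_def by (subst card_SigmaI) (auto simp: B_def finite_Image)
  finally have "excess V R \<le> card D" .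
  have "D \<inter> D\<inverse> = {}" using sparse by (fastforce simp: D_def B_def)
  moreover have fD: "finite D" using DR fR by (meson finite_Diff finite_subset)
  ultimately have "card (D \<union> D\<inverse>) = 2 * card D"
    by (subst card_Un_disjoint) (auto simp: card_inverse)
  \<comment> \<open>Both relations are symmetric, so the reversals of missing arcs are missing too;
    this yields the factor 2.\<close>
  moreover have "D \<union> D\<inverse> \<subseteq> R - S" using DR assms(3) S(2) by (auto simp: sym_def)
  then have "card (D \<union> D\<inverse>) \<le> card (R - S)" using fR by (intro card_mono) auto
  moreover have "card R = card S + card (R - S)"
    using S(1) fR by (metis card_Diff_subset card_mono finite_subset le_add_diff_inverse)
  ultimately show ?thesis using \<open>excess V R \<le> card D\<close> by simp
qed

subsection \<open>Undirected trees and path coverings\<close>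

text \<open>Cycles in \<open>undirected_tree\<close> are lists of arcs, while
  \<open>cycle_free\<close> speaks of vertices; choosing an arc for each consecutive pair translates
  between them.\<close>

lemma vwalk_imp_awalk:
  assumes "p \<noteq> []" "set p \<subseteq> verts G" "set (vwalk_arcs p) \<subseteq> arcs_ends G"
  shows "\<exists>es. pre_digraph.awalk G (hd p) es (last p) \<and> pre_digraph.awalk_verts G (hd p) es = p"
  using assms
proof (induction p rule: vwalk_arcs.induct)
  case (2 x)
  then show ?case
    by (intro exI[of _ "[]"]) (auto simp: pre_digraph.awalk_def pre_digraph.cas.simps
      pre_digraph.awalk_verts.simps)
next
  case (3 x y p)
  then obtain es where es: "pre_digraph.awalk G y es (last (y # p))"
    "pre_digraph.awalk_verts G y es = y # p" by auto
  obtain e where "e \<in> arcs G" "tail G e = x" "head G e = y" using 3(3,4) by auto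
  then show ?case using es 3(3)
    by (intro exI[of _ "e # es"]) (auto simp: pre_digraph.awalk_def pre_digraph.cas.simps
      pre_digraph.awalk_verts.simps)
qed simp

lemma undirected_tree_cycle_free:
  assumes "undirected_tree T"
  shows "cycle_free (arcs_ends T)"
  unfolding cycle_free_def
proof (intro allI impI notI)
  interpret graph T using assms by (simp add: undirected_tree_def)
  fix p assume p: "distinct p" "length p \<ge> 3" "path_edges p \<subseteq> arcs_ends T"
    "(last p, hd p) \<in> arcs_ends T"
  obtain x ps where xps: "p = x # ps" "ps \<noteq> []" using p(2) by (cases p; cases "tl p") auto
  have "path_edges (p @ [x]) \<subseteq> arcs_ends T"
    using p(3,4) xps(1) arcs_ends_symmetric[OF sym_arcs] path_edges_append[of p "[x]"] by auto
  then have w: "set (vwalk_arcs (p @ [x])) \<subseteq> arcs_ends T"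
    by (auto simp: path_edges_eq_vwalk_arcs)
  \<comment> \<open>Since \<open>p\<close> has more than one entry, each entry is an end of some
    edge of \<open>p\<close>.\<close>
  have "set p \<subseteq> verts T"
  proof
    fix v assume "v \<in> set p"
    then obtain xs ys where "p = xs @ v # ys" by (meson split_list)
    then show "v \<in> verts T" using p(3,4) xps
      by (cases "xs = []"; cases ys) (auto simp: path_edges_append dest: adj_in_verts)
  qed
  then obtain es where es: "awalk x es x" "awalk_verts x es = p @ [x]"
    using vwalk_imp_awalk[of "p @ [x]" T] w xps by auto
  have "length es = length p" using es(2) length_awalk_verts[of x es] by simp
  moreover have "cycle es"
    unfolding cycle_def using es p(1,2) xps \<open>length es = length p\<close> by auto
  ultimately show False using assms p(2) by (auto simp: undirected_tree_def)
qed

text \<open>Without parallel arcs, the arcs leaving a vertex are determined by their heads.\<close>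

lemma (in digraph) degree_eq_card_Image: "degree G v = card (arcs_ends G `` {v})"
proof -
  have "arcs_ends G `` {v} = head G ` out_arcs G v"
    by (auto simp: arcs_ends_conv)
  moreover have "inj_on (head G) (out_arcs G v)"
    by (rule inj_onI, rule no_multi_arcs) (auto simp: arc_to_ends_def)
  ultimately show ?thesis by (simp add: out_degree_def card_image)
qed

lemma path_covering_iff_path_partition:
  assumes "symmetric G"
  shows "path_covering G P \<longleftrightarrow>
    path_partition (verts G) P \<and> (\<Union>p\<in>P. path_edges p) \<subseteq> arcs_ends G"
proof -
  have "path_edges p \<subseteq> arcs_ends G \<longleftrightarrow> set (vwalk_arcs p) \<subseteq> arcs_ends G" for p
    using arcs_ends_symmetric[OF assms] by (auto simp: path_edges_eq_vwalk_arcs)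
  then show ?thesis
    by (auto simp: path_covering_def path_partition_def vpath_def vwalk_def UN_subset_iff)
qed

lemma path_covering_number_le: "path_covering G P \<Longrightarrow> path_covering_number G \<le> card P"
  unfolding path_covering_number_def by (intro Least_le) auto

theorem theorem12:
  fixes T :: "('a, 'b) pre_digraph" and l :: nat
  assumes "undirected_tree T"
    and "card (leaves T) = l"
    and "l \<ge> 2"
  shows "two_sparse T \<longleftrightarrow> path_covering_number T = l - 1"
proof -
  interpret graph T using assms(1) by (simp add: undirected_tree_def)
  define V where "V = verts T"
  define R where "R = arcs_ends T"
  have V: "finite V" and RV: "R \<subseteq> V \<times> V" and R: "sym R" "irrefl R"
    using sym_arcs by (auto simp: V_def R_def symmetric_def irrefl_def dest: adj_in_verts adj_not_same)
  have cf: "cycle_free R" using undirected_tree_cycle_free[OF assms(1)] by (simp add: R_def)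
  have "strongly_connected T"
    using assms(1) symmetric_connected_imp_strongly_connected[OF sym_arcs]
    by (simp add: undirected_tree_def)
  then have VR: "V \<noteq> {}" "V \<times> V \<subseteq> R\<^sup>*"
    by (auto simp: strongly_connected_def V_def R_def dest: reachable_rtranclI)
  have cR: "card R + 2 = 2 * card V"
    by (rule card_tree_edges[OF V RV R cf VR])
  have leaves: "leaves T = {v \<in> V. card (R `` {v}) = 1}"
    by (simp add: leaves_def V_def R_def degree_eq_card_Image)
  \<comment> \<open>Two leaves guarantee a second vertex, and a walk from \<open>v\<close> to it
    must start with an arc at \<open>v\<close>.\<close>
  have nonempty: "R `` {v} \<noteq> {}" if "v \<in> V" for v
  proof -
    have "card (leaves T) \<le> card V" using V leaves by (intro card_mono) auto
    then have "\<not> V \<subseteq> {v}" using assms(2,3) card_mono[of "{v}" V] by auto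
    then obtain w where "w \<in> V" "w \<noteq> v" by auto
    then have "(v, w) \<in> R\<^sup>*" using VR(2) that by auto
    then show ?thesis using \<open>w \<noteq> v\<close> by (auto elim: converse_rtranclE)
  qed
  have ex: "excess V R + 2 = l"
    using tree_excess[OF V RV cR nonempty] assms(2) leaves by simp
  have sparse: "two_sparse T \<longleftrightarrow>
      (\<forall>u v. (u, v) \<in> R \<longrightarrow> card (R `` {u}) > 2 \<longrightarrow> card (R `` {v}) \<le> 2)"
    unfolding two_sparse_def R_def degree_eq_card_Image by (meson not_le)
  have cov: "path_covering T P \<longleftrightarrow> path_partition V P \<and> (\<Union>p\<in>P. path_edges p) \<subseteq> R" for P
    using path_covering_iff_path_partition[OF sym_arcs] by (simp add: V_def R_def)
  have upper: "path_covering_number T \<le> l - 1"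
  proof -
    obtain P where "path_covering T P" "card R + 2 * card P \<le> 2 * card V + 2 * excess V R"
      using exists_path_partition[OF V RV R cf] cov by blast
    then show ?thesis using path_covering_number_le[of T P] cR ex by simp
  qed
  show ?thesis
  proof
    assume "two_sparse T"
    obtain P where P: "path_covering T P" "card P = path_covering_number T"
      using path_covering_number_attained[of T] V by (auto simp: V_def)
    \<comment> \<open>The edges kept by a minimum covering: their number determines
      \<open>card P\<close>, and the sparse bound limits it from above.\<close>
    define S where "S = (\<Union>p\<in>P. path_edges p)"
    have "sym S" using sym_path_edges by (fastforce simp: S_def sym_def)
    then have "card S + 2 * excess V R \<le> card R"
      using \<open>two_sparse T\<close> sparse P(1) cov path_partition_degree_le[of V P]
      by (intro two_sparse_excess_le[OF V RV R(1)]) (auto simp: S_def)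
    then have "l - 1 \<le> card P"
      using card_edges_path_partition[of V P] P(1) cov cR ex by (simp add: S_def)
    then show "path_covering_number T = l - 1" using upper P(2) by simp
  next
    assume number: "path_covering_number T = l - 1"
    show "two_sparse T"
    proof (rule ccontr)
      assume "\<not> two_sparse T"
      then obtain u v where uv: "(u, v) \<in> R" "card (R `` {u}) > 2" "card (R `` {v}) > 2"
        using sparse by (auto simp: not_le)
      \<comment> \<open>Removing this edge first costs one extra path but lowers the excess by at
        least 2. Covering the remaining forest greedily then takes at most l - 2 paths.\<close>
      define S where "S = R - {(u, v), (v, u)}"
      have "finite R" using V RV by (meson finite_SigmaI finite_subset)
      note rem = remove_edge[OF this R uv(1), folded S_def]
      obtain P where P: "path_partition V P" "(\<Union>p\<in>P. path_edges p) \<subseteq> S"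
        "card S + 2 * card P \<le> 2 * card V + 2 * excess V S"
        using exists_path_partition[of V S] V RV rem(1-3) cf cycle_free_subset by blast
      have "excess V S + 2 \<le> excess V R"
        using excess_remove_edge[OF V RV R uv(1,2)] uv(3) by (simp add: S_def)
      then have "card P + 1 \<le> l - 1" using P(3) rem(4) cR ex by simp
      moreover have "path_covering T P" using P(1,2) rem(1) cov by auto
      ultimately show False using number path_covering_number_le[of T P] by simp
    qed
  qed
qed

end
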